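(* Let $r, s \geq 1$ with $1/r + 1/s > 1$. There are constants $c, C>0$ such that for every natural number $k$ and every $\eta \in (0,1)$ there exist finite sums $\mu_k$ and $\nu_k$ of point masses in $\mathbb{R}^3$ such that (a) $\langle \mathcal M_{\mathfrak z,d}\, \mu_k , \nu_k \rangle \geq c\, 2^k$, and (b) $\displaystyle\sum_{R\in \mathscr{S}_{\mathfrak z}} \langle \mu_k \rangle_{R,r}\, \langle \nu_k \rangle_{R,s}\, |R| \leq \frac{C}{\eta}\, k^{1/s} \left( 1 + \frac{1}{k} \right)$ for all $\eta$-sparse collections $\mathscr{S}_{\mathfrak z}$ of Zygmund dyadic rectangles.
   Context: $\mathscr{D}$ denotes the dyadic intervals $[k2^{-j},(k+1)2^{-j})$, $j,k\in\mathbb{Z}$. A Zygmund dyadic rectangle is $R=I\times J\times S$ with $I,J,S\in\mathscr{D}$ and $|S|=|I|\cdot|J|$. For a finite set $\mathcal F\subset\mathbb{R}^3$, the associated finite sum of point masses is $\mu=\frac{1}{\sharp\mathcal F}\sum_{p\in\mathcal F}\delta_p$. For such $\mu$ (with set $\mathcal F$) and $\nu$ (with set $\mathcal G$): $\mathcal M_{\mathfrak z,d}\,\mu(x)=\frac{1}{\sharp\mathcal F}\sup_{R}\frac{\sharp(R\cap\mathcal F)}{|R|}$, supremum over Zygmund dyadic rectangles $R\ni x$; $\langle h,\nu\rangle=\frac{1}{\sharp\mathcal G}\sum_{q\in\mathcal G}h(q)$; and for $1\le r<\infty$, $\langle\mu\rangle_{R,r}=\frac{1}{\sharp\mathcal F}\big(\frac{\sharp(R\cap\mathcal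 F)}{|R|}\big)^{1/r}$. For $\eta\in(0,1)$, a collection $\mathscr{S}$ of sets of finite measure is $\eta$-sparse if for each $R\in\mathscr{S}$ there is a measurable $E_R\subset R$ with $|E_R|\ge\eta|R|$ and the sets $E_R$ are pairwise disjoint. *)

theory Defs
  imports "HOL-Analysis.Analysis"
begin

type_synonym pt3 = "real \<times> real \<times> real"

definition dyadic_int :: "int \<Rightarrow> int \<Rightarrow> real set" where
  "dyadic_int j k = {real_of_int k * 2 powr (- real_of_int j) ..< (real_of_int k + 1) * 2 powr (- real_of_int j)}"

definition dyadic :: "real set \<Rightarrow> bool" where
  "dyadic I \<longleftrightarrow> (\<exists>j k. I = dyadic_int j k)"

definition zyg_rect :: "pt3 set \<Rightarrow> bool" where
  "zyg_rect R \<longleftrightarrow> (\<exists>I J S. dyadic I \<and> dyadic J \<and> dyadic S \<and>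
      measure lborel S = measure lborel I * measure lborel J \<and> R = I \<times> J \<times> S)"

definition vol :: "pt3 set \<Rightarrow> real" where
  "vol R = measure lebesgue R"

text \<open>Dyadic Zygmund maximal function of mu = (1/#F) sum_{p in F} delta_p.\<close>
definition Mzd :: "pt3 set \<Rightarrow> pt3 \<Rightarrow> ennreal" where
  "Mzd F x = (SUP R \<in> {R. zyg_rect R \<and> x \<in> R}. ennreal (real (card (R \<inter> F)) / vol R))
              / of_nat (card F)"

text \<open>Pairing <h, nu> for nu = (1/#G) sum_{q in G} delta_q.\<close>
definition pairing :: "(pt3 \<Rightarrow> ennreal) \<Rightarrow> pt3 set \<Rightarrow> ennreal" where
  "pairing h G = (\<Sum>q\<in>G. h q) / of_nat (card G)"

definition avg :: "pt3 set \<Rightarrow> pt3 set \<Rightarrow> real \<Rightarrow> real" where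
  "avg F R r = (1 / real (card F)) * (real (card (R \<inter> F)) / vol R) powr (1 / r)"

definition sparse :: "real \<Rightarrow> pt3 set set \<Rightarrow> bool" where
  "sparse \<eta> \<S> \<longleftrightarrow> (\<forall>R\<in>\<S>. R \<in> sets lebesgue \<and> emeasure lebesgue R < \<infinity>) \<and>
     (\<exists>E. (\<forall>R\<in>\<S>. E R \<in> sets lebesgue \<and> E R \<subseteq> R \<and> measure lebesgue (E R) \<ge> \<eta> * measure lebesgue R) \<and>
          (\<forall>R\<in>\<S>. \<forall>R'\<in>\<S>. R \<noteq> R' \<longrightarrow> E R \<inter> E R' = {}))"

end

theory Submission
  imports Defs
begin

text \<open>
  Take a planar net of $2^n$ points whose binary digits satisfy \<open>y\<close> = reversal of \<open>x\<close>, so that every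
  dyadic rectangle of area $2^{-n}$ in the unit square holds exactly one of them. To each net point
  attach, for every shape $(2^{-a}, 2^{-(n+k-a)})$, a satellite sharing with it the dyadic rectangle of
  that shape. Crossing both sets with a fine grid in the third coordinate gives \<open>F\<close> and \<open>G\<close>. The maximal function
  of \<open>F\<close> is at least $2^k$ at every satellite.

  For the sparse form, rectangles of base area at least $2^{-n}$ see both measures as at most Lebesgue measure.
  All digits of a satellite outside the window forced by its shape are complemented, so a smaller
  rectangle meeting both sets has base area at least $2^{-n-k}$ and contains satellites of at most \<open>k\<close> of
  the $n-k+1$ shapes; for \<open>n\<close> exponentially large in \<open>k\<close> its term is at most its volume. Hence every term is
  bounded by the volume times a power $1 + \theta$, with $\theta = 1/r + 1/s - 1 > 0$, of the inverse volume of
  the smallest box with dyadic sides of length at least 1 at the origin containing the rectangle. Sparseness bounds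
  the total volume of the rectangles with a given box, and the sum over boxes is geometric.
\<close>

subsection \<open>Dyadic rectangles\<close>

lemma mem_dyadic_int_iff: "x \<in> dyadic_int j k \<longleftrightarrow> \<lfloor>x * 2 powr real_of_int j\<rfloor> = k"
  unfolding dyadic_int_def floor_eq_iff by (auto simp: powr_minus field_simps)

text \<open>Dyadic intervals are nested: passing from level \<open>j\<close> to a coarser level
  \<open>i\<close> divides the index by \<open>2 ^ nat (j - i)\<close>, so the coarser index depends
  on \<open>k\<close> alone. Levels of either sign are allowed.\<close>

lemma floor_eq_coarser:
  assumes "x \<in> dyadic_int j k" "y \<in> dyadic_int j k" "i \<le> j"
  shows "\<lfloor>x * 2 powr real_of_int i\<rfloor> = \<lfloor>y * 2 powr real_of_int i\<rfloor>"
proof -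
  have key: "\<lfloor>t * 2 powr real_of_int i\<rfloor> = k div 2 ^ nat (j - i)" if "t \<in> dyadic_int j k" for t
  proof -
    have "real_of_int j = real_of_int i + real (nat (j - i))" using assms(3) by simp
    then have e: "2 powr real_of_int j = 2 powr real_of_int i * 2 ^ nat (j - i)"
      by (metis powr_add powr_realpow zero_less_numeral)
    have "\<lfloor>t * 2 powr real_of_int j\<rfloor> = k" using that mem_dyadic_int_iff by simp
    then have "k div 2 ^ nat (j - i) = \<lfloor>t * 2 powr real_of_int j / 2 ^ nat (j - i)\<rfloor>"
      using floor_divide_real_eq_div[of "2 ^ nat (j - i)" "t * 2 powr real_of_int j"] by simp
    then show ?thesis using e by simp
  qed
  show ?thesis using key assms(1,2) by simp
qed

text \<open>A dyadic interval meeting [0,1) either has length at most 1 and lies in [0,1), or is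
  longer and then starts at 0. The truncation in \<open>nat (- j)\<close> covers both cases at
  once.\<close>

lemma dyadic_int_subset_unit_scaled:
  assumes "x \<in> dyadic_int j k" "0 \<le> x" "x < 1"
  shows "dyadic_int j k \<subseteq> {0..<2 ^ nat (- j)}"
proof -
  have k: "\<lfloor>x * 2 powr real_of_int j\<rfloor> = k" using assms(1) mem_dyadic_int_iff by simp
  have k0: "0 \<le> k" using k assms(2) by auto
  have "(real_of_int k + 1) * 2 powr (- real_of_int j) \<le> 2 ^ nat (- j)"
  proof (cases "j \<ge> 0")
    case True
    have "real_of_int k \<le> x * 2 powr real_of_int j" using k by linarith
    also have "\<dots> < 2 ^ nat j" using assms(3) True by (simp add: powr_real_of_int)
    finally have "k < 2 ^ nat j"
      by (metis of_int_less_iff of_int_numeral of_int_power)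
    then have "k + 1 \<le> 2 ^ nat j" by simp
    then have "real_of_int (k + 1) \<le> real_of_int (2 ^ nat j)" by (simp only: of_int_le_iff)
    then show ?thesis using True by (simp add: powr_minus powr_real_of_int field_simps)
  next
    case False
    have "2 powr real_of_int j \<le> 2 powr 0" using False by (intro powr_mono) auto
    then have "x * 2 powr real_of_int j < 1"
      using assms by (smt (verit) mult_left_le powr_zero_eq_one)
    then have "k = 0" using k k0 assms(2) by linarith
    moreover have "2 powr (- real_of_int j) = (2::real) ^ nat (- j)"
      using False by (simp flip: powr_realpow)
    ultimately show ?thesis by simp
  qed
  then show ?thesis using k0 unfolding dyadic_int_def by (auto intro: order_trans[rotated])
qed

lemma measure_dyadic_int: "measure lborel (dyadic_int j k) = 2 powr (- real_of_int j)"
  unfolding dyadic_int_def by (simp add: algebra_simps)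

lemma lebesgue_box:
  assumes "I \<in> sets (borel :: real measure)" "J \<in> sets (borel :: real measure)"
    "S \<in> sets (borel :: real measure)"
  shows "emeasure lebesgue (I \<times> J \<times> S) = emeasure lborel I * emeasure lborel J * emeasure lborel S"
    and "I \<times> J \<times> S \<in> sets lebesgue"
proof -
  have JS: "J \<times> S \<in> sets (borel :: (real \<times> real) measure)"
    using assms by (intro borel_Times) auto
  then have b: "I \<times> J \<times> S \<in> sets (borel :: pt3 measure)"
    using assms by (intro borel_Times) auto
  then show "I \<times> J \<times> S \<in> sets lebesgue" by simp
  have "emeasure lebesgue (I \<times> J \<times> S) = emeasure lborel (I \<times> J \<times> S)"
    using b by (simp add: emeasure_completion)
  also have "\<dots> = emeasure (lborel \<Otimes>\<^sub>M lborel) (I \<times> J \<times> S)" by (simp add: lborel_prod)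
  also have "\<dots> = emeasure lborel I * emeasure lborel (J \<times> S)"
    using assms JS by (intro lborel.emeasure_pair_measure_Times) auto
  also have "emeasure lborel (J \<times> S) = emeasure (lborel \<Otimes>\<^sub>M lborel) (J \<times> S)" by (simp add: lborel_prod)
  also have "\<dots> = emeasure lborel J * emeasure lborel S"
    using assms by (intro lborel.emeasure_pair_measure_Times) auto
  finally show "emeasure lebesgue (I \<times> J \<times> S) = emeasure lborel I * emeasure lborel J * emeasure lborel S"
    by (simp add: mult.assoc)
qed

lemma measure_lebesgue_corner_box:
  "measure lebesgue ({0..<x} \<times> {0..<y} \<times> {0..<z}) = x * y * z"
  "{0..<x} \<times> {0..<y} \<times> {0..<z} \<in> lmeasurable"
  if "0 \<le> x" "0 \<le> y" "0 \<le> z" for x y z :: real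
proof -
  have e: "emeasure lebesgue ({0..<x} \<times> {0..<y} \<times> {0..<z}) = ennreal (x * y * z)"
    using that by (subst lebesgue_box) (auto simp: ennreal_mult)
  show "measure lebesgue ({0..<x} \<times> {0..<y} \<times> {0..<z}) = x * y * z"
    using e that by (simp add: measure_def)
  show "{0..<x} \<times> {0..<y} \<times> {0..<z} \<in> lmeasurable"
    using e lebesgue_box(2)[of "{0..<x}" "{0..<y}" "{0..<z}"] by (intro fmeasurableI) auto
qed

text \<open>The Zygmund condition on the side lengths says that the levels add, since powers of 2
  determine their exponents. This reduces everything below to integer indices.\<close>

lemma zyg_rect_iff:
  "zyg_rect R \<longleftrightarrow> (\<exists>i j k l m. R = dyadic_int i k \<times> dyadic_int j l \<times> dyadic_int (i + j) m)"
proof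
  assume "zyg_rect R"
  then obtain i j g k l m where R: "R = dyadic_int i k \<times> dyadic_int j l \<times> dyadic_int g m"
    and e: "measure lborel (dyadic_int g m) = measure lborel (dyadic_int i k) * measure lborel (dyadic_int j l)"
    unfolding zyg_rect_def dyadic_def by blast
  from e have "2 powr (- real_of_int g) = 2 powr (- real_of_int i + - real_of_int j)"
    unfolding measure_dyadic_int powr_add .
  then have "- real_of_int g = - real_of_int i + - real_of_int j"
    by (subst (asm) powr_inj) auto
  then have "g = i + j" by linarith
  then show "\<exists>i j k l m. R = dyadic_int i k \<times> dyadic_int j l \<times> dyadic_int (i + j) m"
    using R by blast
next
  assume "\<exists>i j k l m. R = dyadic_int i k \<times> dyadic_int j l \<times> dyadic_int (i + j) m"
  then obtain i j k l m where "R = dyadic_int i k \<times> dyadic_int j l \<times> dyadic_int (i + j) m"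
    by blast
  moreover have "measure lborel (dyadic_int (i + j) m)
      = measure lborel (dyadic_int i k) * measure lborel (dyadic_int j l)"
    unfolding measure_dyadic_int powr_add[symmetric] by simp
  ultimately show "zyg_rect R"
    unfolding zyg_rect_def dyadic_def by blast
qed

lemma vol_zyg:
  "vol (dyadic_int i k \<times> dyadic_int j l \<times> dyadic_int (i + j) m) = 2 powr (- 2 * real_of_int (i + j))"
proof -
  have b: "dyadic_int i k \<in> sets borel" for i k unfolding dyadic_int_def by simp
  have e: "emeasure lborel (dyadic_int i k) = ennreal (2 powr (- real_of_int i))" for i k
    unfolding dyadic_int_def by (simp add: algebra_simps)
  have "emeasure lebesgue (dyadic_int i k \<times> dyadic_int j l \<times> dyadic_int (i + j) m)
      = ennreal (2 powr (- 2 * real_of_int (i + j)))"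
    by (subst lebesgue_box[OF b b b]) (simp add: e algebra_simps flip: ennreal_mult powr_add)
  then show ?thesis unfolding vol_def by (simp add: measure_def)
qed

subsection \<open>Binary digits\<close>

text \<open>Digit 0 is the most significant one. Hence dropping trailing digits is integer division
  by a power of 2, and in \<open>bin_val\<close> digit \<open>j\<close> has weight
  \<open>1 / 2 ^ (j + 1)\<close>.\<close>

primrec bin_int :: "nat \<Rightarrow> (nat \<Rightarrow> bool) \<Rightarrow> nat" where
  "bin_int 0 f = 0"
| "bin_int (Suc N) f = 2 * bin_int N f + of_bool (f N)"

definition bin_val :: "nat \<Rightarrow> (nat \<Rightarrow> bool) \<Rightarrow> real" where
  "bin_val N f = real (bin_int N f) / 2 ^ N"

lemma bin_int_less: "bin_int N f < 2 ^ N"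
  by (induction N) auto

lemma bin_int_div: "bin_int (N + d) f div 2 ^ d = bin_int N f"
proof (induction d)
  case (Suc d)
  have "bin_int (N + Suc d) f div 2 ^ Suc d = bin_int (Suc (N + d)) f div 2 div 2 ^ d"
    by (simp add: div_mult2_eq)
  also have "bin_int (Suc (N + d)) f div 2 = bin_int (N + d) f" by simp
  finally show ?case using Suc by simp
qed simp

lemma bin_int_eq_iff: "bin_int N f = bin_int N g \<longleftrightarrow> (\<forall>j<N. f j = g j)"
proof (induction N)
  case (Suc N)
  have "bin_int (Suc N) f = bin_int (Suc N) g \<longleftrightarrow> bin_int N f = bin_int N g \<and> f N = g N"
    by (auto simp: of_bool_def) presburger+
  then show ?case using Suc less_Suc_eq by auto
qed simp

lemma bin_val_range: "0 \<le> bin_val N f" "bin_val N f < 1"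
proof -
  have "real (bin_int N f) < real (2 ^ N)" using bin_int_less by (simp only: of_nat_less_iff)
  then show "0 \<le> bin_val N f" "bin_val N f < 1" by (simp_all add: bin_val_def)
qed

lemma floor_bin_val:
  assumes "M \<le> N"
  shows "\<lfloor>bin_val N f * 2 powr real M\<rfloor> = int (bin_int M f)"
proof -
  have N: "N = M + (N - M)" using assms by simp
  have "(2::real) ^ N = 2 ^ M * 2 ^ (N - M)" using N by (metis power_add)
  then have "bin_val N f * 2 powr real M = real (bin_int N f) / real (2 ^ (N - M))"
    unfolding bin_val_def by (simp add: powr_realpow)
  then show ?thesis
    using bin_int_div[of M "N - M" f] N by (simp only: floor_divide_of_nat_eq)
qed

text \<open>An interval of level \<open>i\<close> lies in one of level \<open>j + 1\<close>, whose
  index encodes the digits up to \<open>j\<close>. Level \<open>i\<close> may exceed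
  \<open>N\<close>, hence the separate bound on \<open>j\<close>. The next lemma is the converse
  direction.\<close>

lemma bin_val_digits_agree:
  assumes "bin_val N f \<in> dyadic_int i k" "bin_val N g \<in> dyadic_int i k" "j < N" "int j < i"
  shows "f j = g j"
proof -
  have "\<lfloor>bin_val N f * 2 powr real (Suc j)\<rfloor> = \<lfloor>bin_val N g * 2 powr real (Suc j)\<rfloor>"
    using floor_eq_coarser[OF assms(1,2), of "int (Suc j)"] assms(4) by simp
  then have "bin_int (Suc j) f = bin_int (Suc j) g"
    using floor_bin_val[of "Suc j" N] assms(3) by (simp del: bin_int.simps of_nat_Suc)
  then show ?thesis using bin_int_eq_iff[of "Suc j" f g] by simp
qed

lemma bin_val_same_dyadic:
  assumes "M \<le> N" "\<And>j. j < M \<Longrightarrow> f j = g j"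
  shows "\<exists>k. bin_val N f \<in> dyadic_int (int M) k \<and> bin_val N g \<in> dyadic_int (int M) k"
  using floor_bin_val[OF assms(1), of f] floor_bin_val[OF assms(1), of g] bin_int_eq_iff[of M f g] assms(2)
  by (simp add: mem_dyadic_int_iff)

lemma card_subsets_agreeing:
  assumes "finite U" "W \<subseteq> U" "Y \<subseteq> Pow U"
    "\<And>x y w. x \<in> Y \<Longrightarrow> y \<in> Y \<Longrightarrow> w \<in> W \<Longrightarrow> w \<in> x \<longleftrightarrow> w \<in> y"
  shows "card Y \<le> 2 ^ (card U - card W)"
proof -
  have "inj_on (\<lambda>x. x - W) Y" using assms(4) by (intro inj_onI) blast
  then have "card Y = card ((\<lambda>x. x - W) ` Y)" by (simp add: card_image)
  also have "\<dots> \<le> card (Pow (U - W))"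
    using assms(1,3) by (intro card_mono) auto
  also have "\<dots> = 2 ^ (card U - card W)"
    using assms(1,2) by (simp add: card_Pow card_Diff_subset finite_subset)
  finally show ?thesis .
qed

subsection \<open>Weighted sparse sums\<close>

text \<open>Group the rectangles by their box. The disjoint sets \<open>E R\<close> lie in the box,
  so the volumes in one group add up to at most the box volume over \<open>\<eta>\<close>. This uses
  up one power of the weight; the remaining power \<open>\<theta>\<close> is summed over all triples
  of exponents as a product of three geometric series.\<close>

lemma sparse_weighted_sum:
  fixes f :: "pt3 set \<Rightarrow> real"
  assumes "finite T" "0 < \<eta>" "0 < \<theta>"
    and E: "\<And>R. R \<in> T \<Longrightarrow> E R \<in> sets lebesgue \<and> E R \<subseteq> R \<and> \<eta> * vol R \<le> measure lebesgue (E R)"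
    and disj: "\<And>R R'. R \<in> T \<Longrightarrow> R' \<in> T \<Longrightarrow> R \<noteq> R' \<Longrightarrow> E R \<inter> E R' = {}"
    and box: "\<And>R. R \<in> T \<Longrightarrow> f R = 0 \<or> (\<exists>a b c. R \<subseteq> {0..<2 ^ a} \<times> {0..<2 ^ b} \<times> {0..<2 ^ c} \<and>
        f R \<le> (1 / 2 ^ (a + b + c)) powr (1 + \<theta>) * vol R)"
  shows "sum f T \<le> (1 / (1 - 2 powr (- \<theta>))) ^ 3 / \<eta>"
proof -
  define T' where "T' = {R \<in> T. f R \<noteq> 0}"
  have fT': "finite T'" using assms(1) by (simp add: T'_def)
  have sumT': "sum f T = sum f T'"
    unfolding T'_def using assms(1) by (intro sum.mono_neutral_right) auto
  define Q :: "nat \<times> nat \<times> nat \<Rightarrow> pt3 set" where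
    "Q = (\<lambda>(a,b,c). {0..<2 ^ a} \<times> {0..<2 ^ b} \<times> {0..<2 ^ c})"
  define w :: "nat \<times> nat \<times> nat \<Rightarrow> real" where "w = (\<lambda>(a,b,c). 1 / 2 ^ (a + b + c))"
  have "\<forall>R\<in>T'. \<exists>t. R \<subseteq> Q t \<and> f R \<le> w t powr (1 + \<theta>) * vol R"
  proof
    fix R assume "R \<in> T'"
    then obtain a b c where "R \<subseteq> {0..<2 ^ a} \<times> {0..<2 ^ b} \<times> {0..<2 ^ c}"
        "f R \<le> (1 / 2 ^ (a + b + c)) powr (1 + \<theta>) * vol R"
      using box unfolding T'_def by blast
    then show "\<exists>t. R \<subseteq> Q t \<and> f R \<le> w t powr (1 + \<theta>) * vol R"
      unfolding Q_def w_def by (intro exI[of _ "(a, b, c)"]) simp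
  qed
  then obtain t where t: "\<And>R. R \<in> T' \<Longrightarrow> R \<subseteq> Q (t R) \<and> f R \<le> w (t R) powr (1 + \<theta>) * vol R"
    by metis
  define \<rho> :: real where "\<rho> = 2 powr (- \<theta>)"
  have \<rho>: "0 < \<rho>" "\<rho> < 1" using assms(3) by (auto simp: \<rho>_def powr_less_one)
  have Qm: "Q p \<in> lmeasurable \<and> measure lebesgue (Q p) = 1 / w p" for p
    by (cases p) (simp add: Q_def w_def measure_lebesgue_corner_box power_add)
  have wpos: "0 < w p" for p by (cases p) (simp add: w_def)
  have w\<theta>: "w (a, b, c) powr \<theta> = \<rho> ^ a * \<rho> ^ b * \<rho> ^ c" for a b c
  proof -
    have "w (a, b, c) = 2 powr (- real (a + b + c))"
      by (simp add: w_def powr_minus powr_realpow field_simps flip: of_nat_add)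
    then have "w (a, b, c) powr \<theta> = \<rho> powr real (a + b + c)"
      by (simp only: \<rho>_def powr_powr) (simp add: algebra_simps)
    then show ?thesis using \<rho> by (simp add: powr_realpow power_add flip: of_nat_add)
  qed
  have layer: "(\<Sum>R | R \<in> T' \<and> t R = p. f R) \<le> w p powr \<theta> / \<eta>" for p
  proof -
    define A where "A = {R \<in> T'. t R = p}"
    have fA: "finite A" using fT' by (simp add: A_def)
    have AT: "A \<subseteq> T" by (auto simp: A_def T'_def)
    have EQ: "E R \<subseteq> Q p" if "R \<in> A" for R
      using that t[of R] E[of R] AT by (auto simp: A_def)
    \<comment> \<open>Lying in a box makes \<open>E R\<close> of finite measure, which additivity of
      the real-valued \<open>measure\<close> requires.\<close>
    have Em: "E R \<in> lmeasurable" if "R \<in> A" for R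
      using fmeasurableI2[of "Q p" lebesgue "E R"] EQ[OF that] Qm E AT that by blast
    have "\<eta> * (\<Sum>R\<in>A. vol R) \<le> (\<Sum>R\<in>A. measure lebesgue (E R))"
      unfolding sum_distrib_left using E AT by (intro sum_mono) blast
    also have "\<dots> = measure lebesgue (\<Union>R\<in>A. E R)"
      using fA Em disj AT
      by (intro measure_UNION'[symmetric]) (auto simp: pairwise_def disjnt_def)
    also have "\<dots> \<le> measure lebesgue (Q p)"
      using EQ Qm fA E AT by (intro measure_mono_fmeasurable) (auto intro!: sets.finite_UN)
    finally have "\<eta> * (\<Sum>R\<in>A. vol R) \<le> 1 / w p" using Qm by simp
    then have v: "(\<Sum>R\<in>A. vol R) \<le> 1 / w p / \<eta>"
      using assms(2) by (simp only: pos_le_divide_eq mult.commute[of _ \<eta>])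
    have "sum f A \<le> (\<Sum>R\<in>A. w p powr (1 + \<theta>) * vol R)"
      using t by (intro sum_mono) (auto simp: A_def)
    also have "\<dots> = w p powr (1 + \<theta>) * (\<Sum>R\<in>A. vol R)" by (simp add: sum_distrib_left)
    also have "\<dots> \<le> w p powr (1 + \<theta>) * (1 / w p / \<eta>)" using v by (intro mult_left_mono) auto
    also have "\<dots> = w p powr \<theta> / \<eta>" using wpos[of p] by (simp add: powr_add)
    finally show ?thesis by (simp add: A_def)
  qed
  define D where "D = t ` T'"
  have "finite (fst ` D \<union> fst ` snd ` D \<union> snd ` snd ` D)" using fT' by (simp add: D_def)
  then obtain M where M: "\<forall>x \<in> fst ` D \<union> fst ` snd ` D \<union> snd ` snd ` D. x < M"
    using finite_nat_set_iff_bounded by blast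
  \<comment> \<open>Enlarging the index set to a cube makes the triple sum factor.\<close>
  have D: "D \<subseteq> {..<M} \<times> {..<M} \<times> {..<M}"
  proof
    fix p assume "p \<in> D"
    then have "fst p < M" "fst (snd p) < M" "snd (snd p) < M" using M by blast+
    then show "p \<in> {..<M} \<times> {..<M} \<times> {..<M}" by (simp add: mem_Times_iff)
  qed
  have geo: "(\<Sum>a<M. \<rho> ^ a) \<le> 1 / (1 - \<rho>)"
    using \<rho> by (simp add: sum_gp_strict divide_right_mono)
  have "sum f T' = (\<Sum>p\<in>D. \<Sum>R | R \<in> T' \<and> t R = p. f R)"
    unfolding D_def using fT' by (rule sum.image_gen)
  also have "\<dots> \<le> (\<Sum>p\<in>D. w p powr \<theta> / \<eta>)" using layer by (intro sum_mono)
  also have "\<dots> \<le> (\<Sum>p \<in> {..<M} \<times> {..<M} \<times> {..<M}. w p powr \<theta> / \<eta>)"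
    using D assms(2) by (intro sum_mono2) auto
  also have "\<dots> = (\<Sum>a<M. \<Sum>b<M. \<Sum>c<M. \<rho> ^ a * \<rho> ^ b * \<rho> ^ c / \<eta>)"
    by (simp only: w\<theta>[symmetric] sum.cartesian_product) (simp add: case_prod_beta)
  also have "\<dots> = (\<Sum>a<M. \<rho> ^ a) * (\<Sum>a<M. \<rho> ^ a) * (\<Sum>a<M. \<rho> ^ a) / \<eta>"
    by (simp only: sum_product sum_distrib_right sum_distrib_left sum_divide_distrib)
      (simp only: mult_ac)
  also have "\<dots> = (\<Sum>a<M. \<rho> ^ a) ^ 3 / \<eta>" by (simp add: power3_eq_cube)
  also have "\<dots> \<le> (1 / (1 - \<rho>)) ^ 3 / \<eta>"
    using geo \<rho> assms(2) by (intro divide_right_mono power_mono sum_nonneg) auto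
  finally show ?thesis unfolding sumT' \<rho>_def .
qed

subsection \<open>The net and its satellites\<close>

text \<open>
  A point is coded by a pair of digit sets \<open>(x, w)\<close>: the first coordinate reads \<open>x\<close> from digit 0 upwards,
  the second one reads it backwards, and both are complemented outside the masks \<open>A\<close> and \<open>B\<close>. The
  last digit \<open>c\<close> separates net points from satellites in both planar coordinates.
\<close>
definition twisted_pt :: "nat \<Rightarrow> nat \<Rightarrow> nat set \<Rightarrow> nat set \<Rightarrow> bool \<Rightarrow> nat set \<times> nat set \<Rightarrow> pt3" where
  "twisted_pt n L A B c = (\<lambda>(x, w).
     (bin_val (Suc n) (\<lambda>j. if j < n then (j \<in> x \<longleftrightarrow> j \<in> A) else c),
      bin_val (Suc n) (\<lambda>j. if j < n then (n - 1 - j \<in> x \<longleftrightarrow> n - 1 - j \<in> B) else c),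
      bin_val L (\<lambda>j. j \<in> w)))"

text \<open>With both masks equal to \<open>UNIV\<close> nothing is complemented: this is the planar
  digit-reversal (Hammersley) net, crossed with the multiples of \<open>1 / 2 ^ L\<close> in
  [0,1).\<close>

definition net :: "nat \<Rightarrow> nat \<Rightarrow> pt3 set" where
  "net n L = twisted_pt n L UNIV UNIV False ` (Pow {..<n} \<times> Pow {..<L})"

text \<open>
  The two codings of a satellite agree exactly on the window \<open>{a - k..<a}\<close>: this prevents it from being
  too close to any net point, not just to its own one.
\<close>
definition satellites :: "nat \<Rightarrow> nat \<Rightarrow> nat \<Rightarrow> pt3 set" where
  "satellites n L k = (\<lambda>(a, xw). twisted_pt n L {..<a} {a - k..} True xw) `
     ({k..n} \<times> Pow {..<n} \<times> Pow {..<L})"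

lemma finite_net: "finite (net n L)" and finite_satellites: "finite (satellites n L k)"
  by (simp_all add: net_def satellites_def)

lemma twisted_pt_unit: "twisted_pt n L A B c xw \<in> {0..<1} \<times> {0..<1} \<times> {0..<1}"
  by (cases xw) (simp add: twisted_pt_def bin_val_range)

text \<open>Two points in one dyadic box share the leading digits seen by each side. As the second
  coordinate reads backwards, its first \<open>nat j\<close> digits are the positions from
  \<open>n - nat j\<close> on. The last clause concerns digit \<open>n\<close>, which stores
  \<open>c\<close>.\<close>

lemma twisted_pt_agree:
  assumes "twisted_pt n L A B c (x, w) \<in> dyadic_int i p \<times> dyadic_int j q \<times> dyadic_int g m"
    and "twisted_pt n L A' B' c' (x', w') \<in> dyadic_int i p \<times> dyadic_int j q \<times> dyadic_int g m"
  shows "h < n \<Longrightarrow> h < nat i \<Longrightarrow> (h \<in> x \<longleftrightarrow> h \<in> A) = (h \<in> x' \<longleftrightarrow> h \<in> A')"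
    and "h < n \<Longrightarrow> n - nat j \<le> h \<Longrightarrow> (h \<in> x \<longleftrightarrow> h \<in> B) = (h \<in> x' \<longleftrightarrow> h \<in> B')"
    and "h < L \<Longrightarrow> h < nat g \<Longrightarrow> h \<in> w \<longleftrightarrow> h \<in> w'"
    and "n < nat i \<or> n < nat j \<Longrightarrow> c = c'"
proof -
  note m = assms[unfolded twisted_pt_def split mem_Times_iff fst_conv snd_conv]
  have 1: "(if h < n then (h \<in> x \<longleftrightarrow> h \<in> A) else c) = (if h < n then (h \<in> x' \<longleftrightarrow> h \<in> A') else c')"
    if "h < Suc n" "h < nat i" for h
    by (rule bin_val_digits_agree[of "Suc n" _ i p]) (use m that in auto)
  have 2: "(if h < n then (n - 1 - h \<in> x \<longleftrightarrow> n - 1 - h \<in> B) else c)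
      = (if h < n then (n - 1 - h \<in> x' \<longleftrightarrow> n - 1 - h \<in> B') else c')"
    if "h < Suc n" "h < nat j" for h
    by (rule bin_val_digits_agree[of "Suc n" _ j q]) (use m that in auto)
  show "h < n \<Longrightarrow> h < nat i \<Longrightarrow> (h \<in> x \<longleftrightarrow> h \<in> A) = (h \<in> x' \<longleftrightarrow> h \<in> A')"
    using 1[of h] by simp
  show "(h \<in> x \<longleftrightarrow> h \<in> B) = (h \<in> x' \<longleftrightarrow> h \<in> B')" if "h < n" "n - nat j \<le> h"
  proof -
    have "n - 1 - (n - 1 - h) = h" "n - 1 - h < n" "n - 1 - h < nat j" using that by auto
    then show ?thesis using 2[of "n - 1 - h"] by simp
  qed
  show "h \<in> w \<longleftrightarrow> h \<in> w'" if "h < L" "h < nat g"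
    by (rule bin_val_digits_agree[of L _ g m]) (use m that in auto)
  show "n < nat i \<or> n < nat j \<Longrightarrow> c = c'"
    using 1[of n] 2[of n] by auto
qed

lemma twisted_pt_eqD:
  assumes "twisted_pt n L A B c (x, w) = twisted_pt n L A' B' c' (x', w')"
  shows "h < n \<Longrightarrow> (h \<in> x \<longleftrightarrow> h \<in> A) = (h \<in> x' \<longleftrightarrow> h \<in> A')"
    and "h < n \<Longrightarrow> (h \<in> x \<longleftrightarrow> h \<in> B) = (h \<in> x' \<longleftrightarrow> h \<in> B')"
    and "h < L \<Longrightarrow> h \<in> w \<longleftrightarrow> h \<in> w'"
proof -
  \<comment> \<open>A level finer than all digits: equal points share a box of this level, which
    then exposes every digit.\<close>
  define i where "i = int (Suc (n + L))"
  obtain p q m where *: "twisted_pt n L A B c (x, w) \<in> dyadic_int i p \<times> dyadic_int i q \<times> dyadic_int i m"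
    by (cases "twisted_pt n L A B c (x, w)") (simp add: mem_dyadic_int_iff)
  note a = twisted_pt_agree[OF * *[unfolded assms]]
  show "h < n \<Longrightarrow> (h \<in> x \<longleftrightarrow> h \<in> A) = (h \<in> x' \<longleftrightarrow> h \<in> A')"
    and "h < n \<Longrightarrow> (h \<in> x \<longleftrightarrow> h \<in> B) = (h \<in> x' \<longleftrightarrow> h \<in> B')"
    and "h < L \<Longrightarrow> h \<in> w \<longleftrightarrow> h \<in> w'"
    using a(1-3)[of h] by (simp_all add: i_def)
qed

section \<open>Cardinalities, and counts inside dyadic boxes\<close>

lemma card_net: "card (net n L) = 2 ^ n * 2 ^ L"
proof -
  have "inj_on (twisted_pt n L UNIV UNIV False) (Pow {..<n} \<times> Pow {..<L})"
  proof (rule inj_onI, clarify)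
    fix x w x' w' assume s: "x \<subseteq> {..<n}" "w \<subseteq> {..<L}" "x' \<subseteq> {..<n}" "w' \<subseteq> {..<L}"
      and e: "twisted_pt n L UNIV UNIV False (x, w) = twisted_pt n L UNIV UNIV False (x', w')"
    have "h \<in> x \<longleftrightarrow> h \<in> x'" for h
      using twisted_pt_eqD(1)[OF e, of h] s by (cases "h < n") auto
    moreover have "h \<in> w \<longleftrightarrow> h \<in> w'" for h
      using twisted_pt_eqD(3)[OF e, of h] s by (cases "h < L") auto
    ultimately show "x = x' \<and> w = w'" by blast
  qed
  then show ?thesis by (simp add: net_def card_image card_Pow card_cartesian_product)
qed

text \<open>Whether the two digits stored for position \<open>h\<close> agree does not depend on
  \<open>x\<close>: it tells exactly whether \<open>h\<close> lies in the window
  \<open>{a - k..<a}\<close>. Since \<open>1 \<le> k\<close>, the window is nonempty and its top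
  position determines \<open>a\<close>; after that \<open>x\<close> and \<open>w\<close> can be read
  off.\<close>

lemma card_satellites:
  assumes "1 \<le> k" "k \<le> n"
  shows "card (satellites n L k) = (n - k + 1) * (2 ^ n * 2 ^ L)"
proof -
  have "inj_on (\<lambda>(a, xw). twisted_pt n L {..<a} {a - k..} True xw)
     ({k..n} \<times> Pow {..<n} \<times> Pow {..<L})"
  proof (rule inj_onI)
    fix y y' assume y: "y \<in> {k..n} \<times> Pow {..<n} \<times> Pow {..<L}" "y' \<in> {k..n} \<times> Pow {..<n} \<times> Pow {..<L}"
      and eq: "(\<lambda>(a, xw). twisted_pt n L {..<a} {a - k..} True xw) y
        = (\<lambda>(a, xw). twisted_pt n L {..<a} {a - k..} True xw) y'"
    obtain a x w a' x' w' where yy: "y = (a, x, w)" "y' = (a', x', w')" by (metis surj_pair)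
    have s: "x \<subseteq> {..<n}" "w \<subseteq> {..<L}" "x' \<subseteq> {..<n}" "w' \<subseteq> {..<L}" "k \<le> a" "a \<le> n" "k \<le> a'" "a' \<le> n"
      using y yy by auto
    have e: "twisted_pt n L {..<a} {a - k..} True (x, w) = twisted_pt n L {..<a'} {a' - k..} True (x', w')"
      using eq yy by simp
    have X: "(h \<in> x \<longleftrightarrow> h < a) = (h \<in> x' \<longleftrightarrow> h < a')" if "h < n" for h
      using twisted_pt_eqD(1)[OF e that] by simp
    have Y: "(h \<in> x \<longleftrightarrow> a - k \<le> h) = (h \<in> x' \<longleftrightarrow> a' - k \<le> h)" if "h < n" for h
      using twisted_pt_eqD(2)[OF e that] by simp
    have both: "(h < b \<longleftrightarrow> b - k \<le> h) \<longleftrightarrow> h < b \<and> b - k \<le> h" for b h by arith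
    have "h < a \<and> a - k \<le> h \<longleftrightarrow> h < a' \<and> a' - k \<le> h" if "h < n" for h
      using X[OF that] Y[OF that] both[of h a] both[of h a'] by argo
    moreover have "a - 1 < n" "a - 1 < a" "a - k \<le> a - 1" "a' - 1 < n" "a' - 1 < a'" "a' - k \<le> a' - 1"
      using s(5-8) assms by auto
    \<comment> \<open>The top of each window belongs to the other window.\<close>
    ultimately have "a - 1 < a'" "a' - 1 < a" by blast+
    then have a: "a = a'" by arith
    have "h \<in> x \<longleftrightarrow> h \<in> x'" for h
      using X[of h] s a by (cases "h < n") auto
    moreover have "h \<in> w \<longleftrightarrow> h \<in> w'" for h
      using twisted_pt_eqD(3)[OF e, of h] s by (cases "h < L") auto
    ultimately show "y = y'" using a yy by blast
  qed
  then show ?thesis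
    using assms by (simp add: satellites_def card_image card_Pow card_cartesian_product Suc_diff_le)
qed

text \<open>For fixed masks the complementation cancels in comparisons, so the box fixes the digits
  of \<open>x\<close> in the two end segments forming \<open>W\<close> and the first
  \<open>nat g\<close> digits of \<open>w\<close>; only the others are free. If the segments cover
  everything, the truncated exponent is 0 and at most one \<open>x\<close> remains.\<close>

lemma card_twisted_in_rect:
  assumes "nat i \<le> n" "nat j \<le> n"
  shows "card {xw \<in> Pow {..<n} \<times> Pow {..<L}.
      twisted_pt n L A B c xw \<in> dyadic_int i p \<times> dyadic_int j q \<times> dyadic_int g m}
    \<le> 2 ^ (n - (nat i + nat j)) * 2 ^ (L - nat g)"
proof -
  define Z where "Z = {xw \<in> Pow {..<n} \<times> Pow {..<L}.
      twisted_pt n L A B c xw \<in> dyadic_int i p \<times> dyadic_int j q \<times> dyadic_int g m}"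
  define W where "W = {..<nat i} \<union> {n - nat j..<n}"
  have agree: "(h \<in> W \<longrightarrow> (h \<in> x \<longleftrightarrow> h \<in> x')) \<and> (h < min L (nat g) \<longrightarrow> (h \<in> w \<longleftrightarrow> h \<in> w'))"
    if "(x, w) \<in> Z" "(x', w') \<in> Z" for x w x' w' h
  proof -
    have z: "twisted_pt n L A B c (x, w) \<in> dyadic_int i p \<times> dyadic_int j q \<times> dyadic_int g m"
      "twisted_pt n L A B c (x', w') \<in> dyadic_int i p \<times> dyadic_int j q \<times> dyadic_int g m"
      using that by (simp_all add: Z_def)
    show ?thesis
      using twisted_pt_agree(1-3)[OF z, of h] assms by (auto simp: W_def)
  qed
  have "n - (nat i + nat j) = n - card W"
  proof (cases "nat i + nat j \<le> n")
    case True
    then have "card W = nat i + nat j"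
      unfolding W_def using assms by (subst card_Un_disjoint) auto
    then show ?thesis by simp
  next
    case False
    then have "W = {..<n}" unfolding W_def using assms by auto
    then show ?thesis using False by simp
  qed
  moreover have "card (fst ` Z) \<le> 2 ^ (card {..<n} - card W)"
  proof (rule card_subsets_agreeing)
    show "W \<subseteq> {..<n}" using assms by (auto simp: W_def)
    show "fst ` Z \<subseteq> Pow {..<n}" by (auto simp: Z_def)
    show "h \<in> x \<longleftrightarrow> h \<in> x'" if "x \<in> fst ` Z" "x' \<in> fst ` Z" "h \<in> W" for x x' h
    proof -
      obtain w w' where "(x, w) \<in> Z" "(x', w') \<in> Z" using \<open>x \<in> fst ` Z\<close> \<open>x' \<in> fst ` Z\<close> by force
      from agree[OF this, of h] that(3) show ?thesis by simp
    qed
  qed simp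
  ultimately have 1: "card (fst ` Z) \<le> 2 ^ (n - (nat i + nat j))" by simp
  have "card (snd ` Z) \<le> 2 ^ (card {..<L} - card {..<min L (nat g)})"
  proof (rule card_subsets_agreeing)
    show "snd ` Z \<subseteq> Pow {..<L}" by (auto simp: Z_def)
    show "h \<in> w \<longleftrightarrow> h \<in> w'" if "w \<in> snd ` Z" "w' \<in> snd ` Z" "h \<in> {..<min L (nat g)}" for w w' h
    proof -
      obtain x x' where "(x, w) \<in> Z" "(x', w') \<in> Z" using \<open>w \<in> snd ` Z\<close> \<open>w' \<in> snd ` Z\<close> by force
      from agree[OF this, of h] that(3) show ?thesis by simp
    qed
  qed auto
  also have "card {..<L} - card {..<min L (nat g)} = L - nat g" by simp
  finally have 2: "card (snd ` Z) \<le> 2 ^ (L - nat g)" .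
  have fin: "finite Z"
    by (rule finite_subset[of _ "Pow {..<n} \<times> Pow {..<L}"]) (auto simp: Z_def)
  have "card Z \<le> card (fst ` Z \<times> snd ` Z)"
    using fin by (intro card_mono finite_cartesian_product finite_imageI subset_fst_snd)
  also have "\<dots> \<le> 2 ^ (n - (nat i + nat j)) * 2 ^ (L - nat g)"
    using 1 2 by (simp add: card_cartesian_product mult_le_mono)
  finally show ?thesis by (simp add: Z_def)
qed

lemma card_net_in_rect:
  assumes "nat i \<le> n" "nat j \<le> n"
  shows "card ((dyadic_int i p \<times> dyadic_int j q \<times> dyadic_int g m) \<inter> net n L)
    \<le> 2 ^ (n - (nat i + nat j)) * 2 ^ (L - nat g)"
proof -
  let ?R = "dyadic_int i p \<times> dyadic_int j q \<times> dyadic_int g m"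
  let ?Z = "{xw \<in> Pow {..<n} \<times> Pow {..<L}. twisted_pt n L UNIV UNIV False xw \<in> ?R}"
  have sub: "?R \<inter> net n L \<subseteq> twisted_pt n L UNIV UNIV False ` ?Z"
  proof
    fix y assume y: "y \<in> ?R \<inter> net n L"
    then obtain xw where "xw \<in> Pow {..<n} \<times> Pow {..<L}" "y = twisted_pt n L UNIV UNIV False xw"
      unfolding net_def by blast
    then show "y \<in> twisted_pt n L UNIV UNIV False ` ?Z" using y by (intro image_eqI[of _ _ xw]) auto
  qed
  have fin: "finite ?Z" by simp
  have "card (?R \<inter> net n L) \<le> card (twisted_pt n L UNIV UNIV False ` ?Z)"
    using sub fin by (intro card_mono finite_imageI)
  also have "\<dots> \<le> card ?Z" using fin by (rule card_image_le)
  also have "\<dots> \<le> 2 ^ (n - (nat i + nat j)) * 2 ^ (L - nat g)" by (rule card_twisted_in_rect[OF assms])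
  finally show ?thesis .
qed

text \<open>The set \<open>As\<close> bounds which shapes can occur in the box, and each shape
  contributes as many points as the net could. It is applied with all shapes for large rectangles
  and with at most \<open>k\<close> shapes for small ones.\<close>

lemma card_satellites_in_rect:
  assumes "nat i \<le> n" "nat j \<le> n" "finite As"
    and "\<And>a xw. a \<in> {k..n} \<Longrightarrow>
      twisted_pt n L {..<a} {a - k..} True xw \<in> dyadic_int i p \<times> dyadic_int j q \<times> dyadic_int g m \<Longrightarrow> a \<in> As"
  shows "card ((dyadic_int i p \<times> dyadic_int j q \<times> dyadic_int g m) \<inter> satellites n L k)
    \<le> card As * (2 ^ (n - (nat i + nat j)) * 2 ^ (L - nat g))"
proof -
  let ?R = "dyadic_int i p \<times> dyadic_int j q \<times> dyadic_int g m"
  let ?Z = "\<lambda>a. {xw \<in> Pow {..<n} \<times> Pow {..<L}. twisted_pt n L {..<a} {a - k..} True xw \<in> ?R}"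
  have "?R \<inter> satellites n L k \<subseteq> (\<Union>a\<in>As. twisted_pt n L {..<a} {a - k..} True ` ?Z a)"
  proof
    fix y assume y: "y \<in> ?R \<inter> satellites n L k"
    then have "y \<in> satellites n L k" by (rule IntD2)
    then obtain t where t: "t \<in> {k..n} \<times> Pow {..<n} \<times> Pow {..<L}"
      "y = (\<lambda>(a, xw). twisted_pt n L {..<a} {a - k..} True xw) t"
      unfolding satellites_def by (rule imageE)
    define a xw where "a = fst t" and "xw = snd t"
    have a: "a \<in> {k..n}" and xw: "xw \<in> Pow {..<n} \<times> Pow {..<L}"
      and e: "y = twisted_pt n L {..<a} {a - k..} True xw"
      using t by (auto simp: a_def xw_def)
    have "y \<in> ?R" using y by (rule IntD1)
    then have "a \<in> As" using assms(4)[OF a, of xw] e by simp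
    moreover have "y \<in> twisted_pt n L {..<a} {a - k..} True ` ?Z a"
      using y e xw by (intro image_eqI[of _ _ xw]) auto
    ultimately show "y \<in> (\<Union>a\<in>As. twisted_pt n L {..<a} {a - k..} True ` ?Z a)" by (rule UN_I)
  qed
  then have "card (?R \<inter> satellites n L k) \<le> card (\<Union>a\<in>As. twisted_pt n L {..<a} {a - k..} True ` ?Z a)"
    using assms(3) by (intro card_mono) auto
  also have "\<dots> \<le> (\<Sum>a\<in>As. card (twisted_pt n L {..<a} {a - k..} True ` ?Z a))"
    using assms(3) by (rule card_UN_le)
  also have "\<dots> \<le> (\<Sum>a\<in>As. 2 ^ (n - (nat i + nat j)) * 2 ^ (L - nat g))"
  proof (rule sum_mono)
    fix a
    have "card (twisted_pt n L {..<a} {a - k..} True ` ?Z a) \<le> card (?Z a)"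
      by (intro card_image_le) simp
    then show "card (twisted_pt n L {..<a} {a - k..} True ` ?Z a)
        \<le> 2 ^ (n - (nat i + nat j)) * 2 ^ (L - nat g)"
      using card_twisted_in_rect[OF assms(1,2)] by (rule order_trans)
  qed
  finally show ?thesis by simp
qed

text \<open>The separating digit \<open>c\<close> forbids sides finer than level \<open>n\<close>.
  If the segments seen by the two sides overlap, every position in the overlap must lie in the
  window of the satellite. This bounds \<open>nat i + nat j\<close> by \<open>n + k\<close> and
  confines \<open>a\<close> to a short range.\<close>

lemma net_satellite_common_rect:
  assumes "twisted_pt n L UNIV UNIV False (x', w') \<in> dyadic_int i p \<times> dyadic_int j q \<times> dyadic_int g m"
    and "twisted_pt n L {..<a} {a - k..} True (x, w) \<in> dyadic_int i p \<times> dyadic_int j q \<times> dyadic_int g m"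
  shows "nat i \<le> n" "nat j \<le> n"
    and "n < nat i + nat j \<Longrightarrow> nat i \<le> a \<and> a + nat j \<le> n + k"
proof -
  show ij: "nat i \<le> n" "nat j \<le> n" using twisted_pt_agree(4)[OF assms] by (simp_all add: linorder_not_less[symmetric]) blast+
  \<comment> \<open>On digits seen by both sides of the rectangle, both codings of the satellite equal the net point.\<close>
  have *: "a - k \<le> h \<and> h < a" if "h < nat i" "n - nat j \<le> h" "h < n" for h
    using twisted_pt_agree(1,2)[OF assms, of h] that by auto
  show "nat i \<le> a \<and> a + nat j \<le> n + k" if "n < nat i + nat j"
  proof -
    \<comment> \<open>The two ends of the overlap give the two inequalities for
      \<open>a\<close>.\<close>
    have "n - nat j \<le> nat i - 1" "nat i - 1 < nat i" "nat i - 1 < n" "n - nat j < nat i" "n - nat j < n"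
      using that ij by linarith+
    then show ?thesis using *[of "nat i - 1"] *[of "n - nat j"] ij by linarith
  qed
qed

section \<open>Averages bounded by densities\<close>

lemma avg_le_density_powr:
  assumes "1 \<le> r" "0 < card F" "0 < vol R" "0 \<le> d" "real (card (R \<inter> F)) \<le> real (card F) * (d * vol R)"
  shows "avg F R r \<le> d powr (1 / r)"
proof -
  have "real (card (R \<inter> F)) / vol R \<le> real (card F) * d"
    using assms by (simp add: field_simps)
  then have "(real (card (R \<inter> F)) / vol R) powr (1 / r) \<le> (real (card F) * d) powr (1 / r)"
    using assms by (intro powr_mono2) auto
  also have "\<dots> = real (card F) powr (1 / r) * d powr (1 / r)"
    using assms by (simp add: powr_mult)
  \<comment> \<open>Since \<open>card F\<close> is at least 1 and \<open>1 / r\<close> at most 1,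
    the factor is absorbed by the normalisation, which stands outside the power in
    \<open>avg\<close>.\<close>
  also have "\<dots> \<le> real (card F) powr 1 * d powr (1 / r)"
    using assms by (intro mult_right_mono powr_mono) auto
  finally show ?thesis using assms by (simp add: avg_def field_simps)
qed

text \<open>A nonzero count over a volume at most 1 is at least 1, so replacing the exponent
  \<open>1 / r\<close> by 1 only increases the average.\<close>

lemma avg_le_density:
  assumes "1 \<le> r" "0 < card F" "0 < vol R" "vol R \<le> 1" "1 \<le> card (R \<inter> F)"
  shows "avg F R r \<le> real (card (R \<inter> F)) / (real (card F) * vol R)"
proof -
  have "1 \<le> real (card (R \<inter> F)) / vol R" using assms by (simp add: field_simps)
  then have "(real (card (R \<inter> F)) / vol R) powr (1 / r) \<le> (real (card (R \<inter> F)) / vol R) powr 1"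
    using assms(1) by (intro powr_mono) auto
  then show ?thesis using assms by (simp add: avg_def field_simps)
qed

lemma avg_nonneg: "0 \<le> avg F R r"
  by (simp add: avg_def)

subsection \<open>The sparse form and the maximal function\<close>

text \<open>If \<open>nat i + nat j \<le> n\<close>, the equidistribution of both sets gives the
  power of the box weight directly. Otherwise the rectangle lies in the unit cube, and the scarcity
  of shapes in it, against the huge total number of shapes, bounds the product of averages by
  1.\<close>

lemma sparse_term_le:
  assumes "1 \<le> r" "1 \<le> s" "1 \<le> k" "zyg_rect R"
    and n: "n = k + k * 4 ^ k" and L: "L = n + k"
    and F: "F = net n L" and G: "G = satellites n L k"
  shows "avg F R r * avg G R s * vol R = 0 \<or>
    (\<exists>a b c. R \<subseteq> {0..<2 ^ a} \<times> {0..<2 ^ b} \<times> {0..<2 ^ c} \<and>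
      avg F R r * avg G R s * vol R \<le> (1 / 2 ^ (a + b + c)) powr (1 / r + 1 / s) * vol R)"
proof (cases "R \<inter> F = {} \<or> R \<inter> G = {}")
  case True
  then show ?thesis by (auto simp: avg_def)
next
  case False
  from assms(4) obtain i j p q m where R: "R = dyadic_int i p \<times> dyadic_int j q \<times> dyadic_int (i + j) m"
    unfolding zyg_rect_iff by blast
  obtain x' w' where P: "twisted_pt n L UNIV UNIV False (x', w') \<in> R"
    using False unfolding F net_def by auto
  obtain a0 x w where Q: "twisted_pt n L {..<a0} {a0 - k..} True (x, w) \<in> R"
    using False unfolding G satellites_def by auto
  \<comment> \<open>Only the net point is fixed here; the satellite stays general, so that the range
    of \<open>a\<close> is later available for every satellite in \<open>R\<close>.\<close>
  note common = net_satellite_common_rect[OF P[unfolded R]]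
  note ij = common(1,2)[OF Q[unfolded R]]
  define a b c where "a = nat (- i)" and "b = nat (- j)" and "c = nat (- (i + j))"
  define d where "d = (1 :: real) / 2 ^ (a + b + c)"
  have sub: "R \<subseteq> {0..<2 ^ a} \<times> {0..<2 ^ b} \<times> {0..<2 ^ c}"
  proof -
    let ?y = "twisted_pt n L UNIV UNIV False (x', w')"
    have y: "?y \<in> dyadic_int i p \<times> dyadic_int j q \<times> dyadic_int (i + j) m"
      "?y \<in> {0..<1} \<times> {0..<1} \<times> {0..<1}"
      using P R twisted_pt_unit by auto
    have "dyadic_int i p \<subseteq> {0..<2 ^ a}" unfolding a_def
      using y by (intro dyadic_int_subset_unit_scaled[of "fst ?y"]) (simp_all add: mem_Times_iff)
    moreover have "dyadic_int j q \<subseteq> {0..<2 ^ b}" unfolding b_def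
      using y by (intro dyadic_int_subset_unit_scaled[of "fst (snd ?y)"]) (simp_all add: mem_Times_iff)
    moreover have "dyadic_int (i + j) m \<subseteq> {0..<2 ^ c}" unfolding c_def
      using y by (intro dyadic_int_subset_unit_scaled[of "snd (snd ?y)"]) (simp_all add: mem_Times_iff)
    ultimately show ?thesis unfolding R by (intro Sigma_mono)
  qed
  have V: "vol R = 2 ^ (a + b + c) / 2 ^ (nat i + nat j + nat (i + j))"
  proof -
    have nat: "int (nat (- z)) - int (nat z) = - z" for z by simp
    have "- 2 * (i + j) = int (a + b + c) - int (nat i + nat j + nat (i + j))"
      unfolding a_def b_def c_def using nat[of i] nat[of j] nat[of "i + j"] by simp
    then have "real_of_int (- 2 * (i + j)) = real_of_int (int (a + b + c) - int (nat i + nat j + nat (i + j)))"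
      by (rule arg_cong)
    then have "- 2 * real_of_int (i + j) = real (a + b + c) - real (nat i + nat j + nat (i + j))"
      by simp
    then have "vol R = 2 powr (real (a + b + c) - real (nat i + nat j + nat (i + j)))"
      unfolding R vol_zyg by simp
    then show ?thesis by (simp only: powr_diff powr_realpow zero_less_numeral)
  qed
  have Vpos: "0 < vol R" unfolding V by simp
  \<comment> \<open>This is the volume of the part of \<open>R\<close> in the unit cube: each side
    is capped at length 1.\<close>
  have dV: "d * vol R = 1 / 2 ^ (nat i + nat j + nat (i + j))" unfolding V d_def by simp
  have cF: "card F = 2 ^ n * 2 ^ L" unfolding F by (rule card_net)
  have cG: "card G = (n - k + 1) * (2 ^ n * 2 ^ L)"
    unfolding G using assms(3) n by (intro card_satellites) auto
  have NF: "card (R \<inter> F) \<le> 2 ^ (n - (nat i + nat j)) * 2 ^ (L - nat (i + j))"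
    unfolding R F by (rule card_net_in_rect[OF ij])
  have "avg F R r * avg G R s * vol R \<le> d powr (1 / r + 1 / s) * vol R"
  proof (cases "nat i + nat j \<le> n")
    case True
    have NG: "card (R \<inter> G) \<le> card {k..n} * (2 ^ (n - (nat i + nat j)) * 2 ^ (L - nat (i + j)))"
      unfolding R G by (rule card_satellites_in_rect[OF ij]) auto
    \<comment> \<open>Guarantees that neither exponent in the count is truncated, so the count is
      exactly proportional to \<open>d * vol R\<close>.\<close>
    have gL: "nat (i + j) \<le> L" using True L by linarith
    have e: "real (2 ^ (n - (nat i + nat j)) * 2 ^ (L - nat (i + j))) = 2 ^ n * 2 ^ L * (d * vol R)"
      unfolding dV of_nat_mult of_nat_power of_nat_numeral using True gL
      by (simp add: power_diff power_add)
    have "real (card (R \<inter> F)) \<le> real (card F) * (d * vol R)"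
      using NF e unfolding cF by (metis of_nat_le_iff of_nat_mult of_nat_numeral of_nat_power)
    then have 1: "avg F R r \<le> d powr (1 / r)"
      using assms(1) Vpos by (intro avg_le_density_powr) (auto simp: cF d_def)
    have "real (card (R \<inter> G)) \<le> real (card {k..n} * (2 ^ (n - (nat i + nat j)) * 2 ^ (L - nat (i + j))))"
      using NG by (simp only: of_nat_le_iff)
    also have "\<dots> = real (card {k..n}) * (2 ^ n * 2 ^ L * (d * vol R))"
      unfolding of_nat_mult[of "card _"] e ..
    also have "\<dots> = real (card G) * (d * vol R)"
      unfolding cG using n by (simp add: algebra_simps)
    finally have 2: "avg G R s \<le> d powr (1 / s)"
      using assms(2) Vpos by (intro avg_le_density_powr) (auto simp: cG d_def)
    have "avg F R r * avg G R s \<le> d powr (1 / r) * d powr (1 / s)"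
      using 1 2 avg_nonneg by (intro mult_mono) auto
    then show ?thesis using Vpos by (simp add: powr_add mult_right_mono)
  next
    case False': False
    define t where "t = nat i + nat j - n"
    have t: "nat i + nat j = n + t" "1 \<le> t" "t \<le> k"
      using False' common(3)[OF Q[unfolded R]] by (auto simp: t_def)
    \<comment> \<open>Neither level exceeds \<open>n\<close> but their sum does. Hence all sides are
      shorter than 1 and the box is the unit cube.\<close>
    have pos: "0 < i" "0 < j" using False' ij by linarith+
    then have ijn: "nat (i + j) = n + t" using t(1) by (simp add: nat_add_distrib)
    have d1: "d = 1" using pos by (simp add: d_def a_def b_def c_def)
    have four: "(4::real) ^ h = 2 ^ h * 2 ^ h" for h by (simp flip: power_mult_distrib)
    have V4: "vol R = 1 / 4 ^ (n + t)"
    proof -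
      have "vol R = 1 / 2 ^ ((n + t) + (n + t))" using dV d1 t(1) ijn by simp
      then show ?thesis by (simp add: power_add four)
    qed
    have V1: "vol R \<le> 1" unfolding V4 by simp
    have NF': "card (R \<inter> F) \<le> 2 ^ (L - (n + t))" using NF t(1) ijn by simp
    define As where "As = {nat i..n + k - nat j}"
    have "card (R \<inter> G) \<le> card As * (2 ^ (n - (nat i + nat j)) * 2 ^ (L - nat (i + j)))"
      unfolding R G
    proof (rule card_satellites_in_rect[OF ij])
      fix a xw
      assume "twisted_pt n L {..<a} {a - k..} True xw
        \<in> dyadic_int i p \<times> dyadic_int j q \<times> dyadic_int (i + j) m"
      then show "a \<in> As"
        using common(3)[of a k "fst xw" "snd xw"] False' by (auto simp: As_def)
    qed (simp add: As_def)
    \<comment> \<open>The range has \<open>k - t + 1\<close> elements, and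
      \<open>1 \<le> t\<close>.\<close>
    also have "card As \<le> k" using t ij by (simp add: As_def)
    finally have NG: "card (R \<inter> G) \<le> k * 2 ^ (L - (n + t))"
      using t(1) ijn by (simp add: mult_le_mono1)
    \<comment> \<open>The choice \<open>L = n + k\<close> makes the vertical grid fine enough for
      every \<open>t \<le> k\<close>.\<close>
    have e: "(2::real) ^ L = 2 ^ (L - (n + t)) * 2 ^ (n + t)"
      using t(3) L by (simp flip: power_add)
    have ratio: "real (card (R \<inter> F)) / real (card F) \<le> 1 / (2 ^ n * 2 ^ (n + t))"
    proof -
      have "real (card (R \<inter> F)) \<le> 2 ^ (L - (n + t))"
        using NF' by (metis of_nat_le_iff of_nat_numeral of_nat_power)
      then show ?thesis unfolding cF by (simp add: e field_simps)
    qed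
    define K where "K = real (n - k + 1)"
    \<comment> \<open>This is what the exponential size of \<open>n\<close> is for: the number of
      shapes \<open>n - k + 1\<close> exceeds \<open>k * 4 ^ k\<close>.\<close>
    have K: "real k * 4 ^ t \<le> K" "0 < K"
    proof -
      have "k * 4 ^ t \<le> k * 4 ^ k" using t(3) by (intro mult_left_mono power_increasing) auto
      then have "k * 4 ^ t \<le> n - k + 1" using n by linarith
      then have "real (k * 4 ^ t) \<le> K" unfolding K_def by (simp only: of_nat_le_iff)
      then show "real k * 4 ^ t \<le> K" by simp
    qed (simp add: K_def)
    have ratio': "real (card (R \<inter> G)) / real (card G) \<le> real k / (K * (2 ^ n * 2 ^ (n + t)))"
    proof -
      have "real (card (R \<inter> G)) \<le> real k * 2 ^ (L - (n + t))"
        using NG by (metis of_nat_le_iff of_nat_mult of_nat_numeral of_nat_power)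
      moreover have "real (card G) = K * (2 ^ n * 2 ^ L)" unfolding cG K_def of_nat_mult[of "n - k + 1"] by simp
      ultimately show ?thesis using K(2) by (simp add: e field_simps)
    qed
    have c1: "1 \<le> card (R \<inter> F)" "1 \<le> card (R \<inter> G)"
      using False finite_net finite_satellites unfolding F G
      by (simp_all add: Suc_le_eq card_gt_0_iff)
    have "avg F R r \<le> (real (card (R \<inter> F)) / real (card F)) / vol R"
      using avg_le_density[OF assms(1) _ Vpos V1 c1(1)] cF by simp
    also have "\<dots> \<le> 1 / (2 ^ n * 2 ^ (n + t)) / vol R"
      using ratio Vpos by (intro divide_right_mono) auto
    finally have A: "avg F R r \<le> 1 / (2 ^ n * 2 ^ (n + t)) / vol R" .
    have "avg G R s \<le> (real (card (R \<inter> G)) / real (card G)) / vol R"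
      using avg_le_density[OF assms(2) _ Vpos V1 c1(2)] cG by simp
    also have "\<dots> \<le> real k / (K * (2 ^ n * 2 ^ (n + t))) / vol R"
      using ratio' Vpos by (intro divide_right_mono) auto
    finally have B: "avg G R s \<le> real k / (K * (2 ^ n * 2 ^ (n + t))) / vol R" .
    have "avg F R r * avg G R s \<le>
        (1 / (2 ^ n * 2 ^ (n + t)) / vol R) * (real k / (K * (2 ^ n * 2 ^ (n + t))) / vol R)"
      using A B avg_nonneg Vpos by (intro mult_mono) auto
    \<comment> \<open>Dividing by \<open>vol R\<close> twice gives \<open>4 ^ (2 * (n + t))\<close>,
      of which the two densities cancel \<open>4 ^ (2 * n + t)\<close>.\<close>
    also have "\<dots> = real k * 4 ^ t / K"
      unfolding V4 four using K(2) by (simp add: power_add)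
    also have "\<dots> \<le> 1" using K by simp
    finally show ?thesis using Vpos by (simp add: d1)
  qed
  then show ?thesis using sub unfolding d_def by blast
qed

text \<open>The rectangle of levels \<open>a\<close>, \<open>n + k - a\<close> and
  \<open>n + k\<close> around a satellite also contains the net point with the same code. One point
  of mass \<open>1 / 2 ^ (n + L)\<close> in volume \<open>1 / 4 ^ L\<close> has density
  \<open>2 ^ (L - n)\<close>, that is \<open>2 ^ k\<close>.\<close>

lemma Mzd_satellite:
  assumes "q \<in> satellites n (n + k) k"
  shows "ennreal (2 ^ k) \<le> Mzd (net n (n + k)) q"
proof -
  define L where "L = n + k"
  obtain a x w where a: "a \<in> {k..n}" "x \<subseteq> {..<n}" "w \<subseteq> {..<L}"
    and q: "q = twisted_pt n L {..<a} {a - k..} True (x, w)"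
    using assms unfolding satellites_def L_def by auto
  define p where "p = twisted_pt n L UNIV UNIV False (x, w)"
  define b where "b = n + k - a"
  have ab: "a \<le> n" "b \<le> n" "a + b = L" "k \<le> a" using a(1) by (auto simp: b_def L_def)
  have "\<exists>u. fst p \<in> dyadic_int (int a) u \<and> fst q \<in> dyadic_int (int a) u"
    unfolding p_def q twisted_pt_def using ab
    by (simp only: split fst_conv) (intro bin_val_same_dyadic, auto)
  \<comment> \<open>The first \<open>b\<close> digits are the positions from
    \<open>n - b = a - k\<close> on, exactly those left uncomplemented by the second mask.\<close>
  moreover have "\<exists>v. fst (snd p) \<in> dyadic_int (int b) v \<and> fst (snd q) \<in> dyadic_int (int b) v"
    unfolding p_def q twisted_pt_def using ab
    by (simp only: split fst_conv snd_conv) (intro bin_val_same_dyadic, auto simp: L_def)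
  moreover have "\<exists>m. snd (snd p) \<in> dyadic_int (int a + int b) m \<and> snd (snd q) \<in> dyadic_int (int a + int b) m"
    unfolding p_def q twisted_pt_def by (simp add: mem_dyadic_int_iff)
  ultimately obtain u v m where
    "p \<in> dyadic_int (int a) u \<times> dyadic_int (int b) v \<times> dyadic_int (int a + int b) m"
    "q \<in> dyadic_int (int a) u \<times> dyadic_int (int b) v \<times> dyadic_int (int a + int b) m"
    by (auto simp: mem_Times_iff)
  moreover define R where "R = dyadic_int (int a) u \<times> dyadic_int (int b) v \<times> dyadic_int (int a + int b) m"
  ultimately have pR: "p \<in> R" and qR: "q \<in> R" by simp_all
  have zR: "zyg_rect R" unfolding zyg_rect_iff R_def by blast
  have vR: "vol R = 1 / (2 ^ L * 2 ^ L)"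
  proof -
    have "- 2 * real_of_int (int a + int b) = - real (L + L)" using ab(3) by simp
    then have "vol R = 2 powr (- real (L + L))" unfolding R_def vol_zyg by (rule arg_cong)
    then show ?thesis by (simp only: powr_minus powr_realpow zero_less_numeral power_add) (simp add: field_simps)
  qed
  have "p \<in> net n L" unfolding p_def net_def using a by blast
  then have "0 < card (R \<inter> net n L)" using pR finite_net by (auto simp: card_gt_0_iff)
  then have "1 \<le> real (card (R \<inter> net n L))" by linarith
  then have "2 ^ L * 2 ^ L \<le> real (card (R \<inter> net n L)) / vol R" unfolding vR by simp
  then have "ennreal (2 ^ L * 2 ^ L) \<le> ennreal (real (card (R \<inter> net n L)) / vol R)"
    by (rule ennreal_leI)
  also have "\<dots> \<le> (SUP R \<in> {R. zyg_rect R \<and> q \<in> R}. ennreal (real (card (R \<inter> net n L)) / vol R))"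
    using zR qR by (intro SUP_upper) auto
  finally have "ennreal (2 ^ L * 2 ^ L) / of_nat (card (net n L)) \<le> Mzd (net n L) q"
    unfolding Mzd_def by (rule divide_right_mono_ennreal)
  also have "ennreal (2 ^ L * 2 ^ L) / of_nat (card (net n L)) = ennreal (2 ^ L * 2 ^ L / real (card (net n L)))"
    by (subst divide_ennreal[symmetric]) (auto simp: card_net ennreal_of_nat_eq_real_of_nat)
  also have "2 ^ L * 2 ^ L / real (card (net n L)) = 2 ^ k"
    by (simp add: card_net L_def power_add)
  finally show ?thesis by (simp add: L_def)
qed

lemma pairing_ge:
  assumes "finite G" "G \<noteq> {}" "\<And>q. q \<in> G \<Longrightarrow> c \<le> h q"
  shows "c \<le> pairing h G"
proof -
  have "of_nat (card G) * c \<le> (\<Sum>q\<in>G. h q)" using sum_mono[of G "\<lambda>_. c" h] assms(3) by simp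
  then have "of_nat (card G) * c / of_nat (card G) \<le> pairing h G"
    unfolding pairing_def by (rule divide_right_mono_ennreal)
  moreover have "of_nat (card G) * c / of_nat (card G) = c"
    using assms(1,2) by (simp add: mult_divide_eq_ennreal mult.commute ennreal_of_nat_eq_real_of_nat)
  ultimately show ?thesis by simp
qed

theorem theorem2p1:
  fixes r s :: real
  assumes "r \<ge> 1" and "s \<ge> 1" and "1 / r + 1 / s > 1"
  shows "\<exists>c C. c > 0 \<and> C > 0 \<and>
    (\<forall>k::nat. k \<ge> 1 \<longrightarrow> (\<forall>\<eta>::real. 0 < \<eta> \<and> \<eta> < 1 \<longrightarrow>
      (\<exists>F G :: pt3 set. finite F \<and> F \<noteq> {} \<and> finite G \<and> G \<noteq> {} \<and>
         pairing (Mzd F) G \<ge> ennreal (c * 2 ^ k) \<and>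
         (\<forall>\<S>. (\<forall>R\<in>\<S>. zyg_rect R) \<and> sparse \<eta> \<S> \<longrightarrow>
            (\<Sum>\<^sub>\<infinity>R\<in>\<S>. ennreal (avg F R r * avg G R s * vol R))
              \<le> ennreal (C / \<eta> * real k powr (1 / s) * (1 + 1 / real k))))))"
proof -
  define \<theta> where "\<theta> = 1 / r + 1 / s - 1"
  have \<theta>: "0 < \<theta>" using assms(3) by (simp add: \<theta>_def)
  define C where "C = (1 / (1 - 2 powr (- \<theta>))) ^ 3"
  have "2 powr (- \<theta>) < 1" using \<theta> by (simp add: powr_less_one)
  then have C: "0 < C" by (simp add: C_def)
  show ?thesis
  \<comment> \<open>The lower bound holds with \<open>c = 1\<close>; \<open>C\<close> is the cube of
    a geometric series and depends only on \<open>\<theta>\<close>.\<close>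
  proof (rule exI[of _ 1], rule exI[of _ C], intro conjI allI impI)
    fix k :: nat and \<eta> :: real
    assume k: "1 \<le> k" and \<eta>: "0 < \<eta> \<and> \<eta> < 1"
    define n L where "n = k + k * 4 ^ k" and "L = n + k"
    define F G where "F = net n L" and "G = satellites n L k"
    have kn: "k \<le> n" by (simp add: n_def)
    have fF: "finite F" "F \<noteq> {}" "finite G" "G \<noteq> {}"
      using finite_net finite_satellites card_net[of n L] card_satellites[OF k kn, of L]
      by (auto simp: F_def G_def)
    have pair: "ennreal (1 * 2 ^ k) \<le> pairing (Mzd F) G"
      using fF Mzd_satellite by (intro pairing_ge) (auto simp: F_def G_def L_def)
    have "(\<Sum>\<^sub>\<infinity>R\<in>\<S>. ennreal (avg F R r * avg G R s * vol R))
              \<le> ennreal (C / \<eta> * real k powr (1 / s) * (1 + 1 / real k))"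
      if S: "(\<forall>R\<in>\<S>. zyg_rect R) \<and> sparse \<eta> \<S>" for \<S>
    \<comment> \<open>Terms are nonnegative, so it suffices to bound finite subfamilies, which
      inherit the sets \<open>E R\<close>.\<close>
    proof (rule infsum_le_finite_sums)
      show "(\<lambda>R. ennreal (avg F R r * avg G R s * vol R)) summable_on \<S>"
        by (rule nonneg_summable_on_complete) simp
      fix T assume T: "finite T" "T \<subseteq> \<S>"
      obtain E where E: "\<And>R. R \<in> \<S> \<Longrightarrow> E R \<in> sets lebesgue \<and> E R \<subseteq> R \<and> \<eta> * vol R \<le> measure lebesgue (E R)"
        "\<And>R R'. R \<in> \<S> \<Longrightarrow> R' \<in> \<S> \<Longrightarrow> R \<noteq> R' \<Longrightarrow> E R \<inter> E R' = {}"
        using S unfolding sparse_def vol_def by metis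
      have "(\<Sum>R\<in>T. avg F R r * avg G R s * vol R) \<le> C / \<eta>"
        unfolding C_def
      proof (rule sparse_weighted_sum[where E = E])
        fix R assume "R \<in> T"
        then have "zyg_rect R" using S T by blast
        from sparse_term_le[OF assms(1,2) k this n_def L_def F_def G_def]
        show "avg F R r * avg G R s * vol R = 0 \<or>
          (\<exists>a b c. R \<subseteq> {0..<2 ^ a} \<times> {0..<2 ^ b} \<times> {0..<2 ^ c} \<and>
            avg F R r * avg G R s * vol R \<le> (1 / 2 ^ (a + b + c)) powr (1 + \<theta>) * vol R)"
          unfolding \<theta>_def by simp
      qed (use T E \<eta> \<theta> in \<open>simp_all add: subset_iff\<close>)
      \<comment> \<open>The bound obtained is uniform in \<open>k\<close>; the factor depending on
        \<open>k\<close> is at least 1.\<close>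
      also have "\<dots> \<le> C / \<eta> * (real k powr (1 / s) * (1 + 1 / real k))"
      proof -
        have "1 * 1 \<le> real k powr (1 / s) * (1 + 1 / real k)"
          using k assms(2) by (intro mult_mono ge_one_powr_ge_zero) auto
        moreover have "0 \<le> C / \<eta>" using C \<eta> by simp
        ultimately show ?thesis using mult_left_mono[of 1 _ "C / \<eta>"] by simp
      qed
      finally have "(\<Sum>R\<in>T. avg F R r * avg G R s * vol R) \<le> C / \<eta> * real k powr (1 / s) * (1 + 1 / real k)"
        by (simp add: mult.assoc)
      then show "(\<Sum>R\<in>T. ennreal (avg F R r * avg G R s * vol R))
          \<le> ennreal (C / \<eta> * real k powr (1 / s) * (1 + 1 / real k))"
        by (subst sum_ennreal) (auto intro!: ennreal_leI mult_nonneg_nonneg avg_nonneg simp: vol_def)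
    qed
    then show "\<exists>F G :: pt3 set. finite F \<and> F \<noteq> {} \<and> finite G \<and> G \<noteq> {} \<and>
         pairing (Mzd F) G \<ge> ennreal (1 * 2 ^ k) \<and>
         (\<forall>\<S>. (\<forall>R\<in>\<S>. zyg_rect R) \<and> sparse \<eta> \<S> \<longrightarrow>
            (\<Sum>\<^sub>\<infinity>R\<in>\<S>. ennreal (avg F R r * avg G R s * vol R))
              \<le> ennreal (C / \<eta> * real k powr (1 / s) * (1 + 1 / real k)))"
      using fF pair by blast
  qed (use C in auto)
qed

end
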